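(* Let $p\geq 3$ be an odd prime and let $\zeta_p:\{\xi\in\mathbb{Z}:\gcd(\xi,p)=1\}\to\{0,1\}$ be a function such that (1) if $\gcd(\theta_1,p)=\gcd(\theta_2,p)=1$ and $\theta_1\equiv\theta_2\pmod p$, then $\zeta_p(\theta_1)=\zeta_p(\theta_2)$; and (2) the sets $A_i=\{a:\zeta_p(a)=i,\ 1\leq a\leq p-1\}$, $i=0,1$, satisfy $|A_0|=|A_1|=\frac{p-1}{2}$. Let $S=\{1,2,\ldots,2p\}$. Then the ladder graph $L_p$ is an arithmetic cordial graph modulo $p$ under $\langle S,\zeta_p,+\rangle$, where $+$ is ordinary addition of integers.
   Context: Ladder graph: $L_n$ is the graph of order $2n$ obtained from two disjoint paths $P_n^1$ and $P_n^2$ on $n$ vertices by joining, for each $i$, the $i$th vertex of $P_n^1$ to the $i$th vertex of $P_n^2$. Arithmetic cordial graph: let $\eta$ be a positive integer, $S\subseteq\mathbb{Z}$, $\star:S\times S\to\mathbb{Z}$ a binary function, and $\zeta_\eta:\{\xi\in\mathbb{Z}:\gcd(\xi,\eta)=1\}\to\{0,1\}$ a function. The triple $\langle S,\zeta_\eta,\star\rangle$ is called an arithmetic structure. For a simple connected graph $G$ of order $n$, a bijection $f:V(G)\to S$ (where $|S|=n$) is an arithmetic cordial labeling modulo $\eta$ under $\langle S,\zeta_\eta,\star\rangle$ if the induced function $f_\eta^*:E(G)\to\{0,1\}$, defined by $f_\eta^*(ab)=0$ if $\gcd(f(a)\star f(b),\eta)\neq 1$ or $\zeta_\eta(f(a)\star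 f(b))=0$, and $f_\eta^*(ab)=1$ if $\gcd(f(a)\star f(b),\eta)=1$ and $\zeta_\eta(f(a)\star f(b))=1$, satisfies $|e_{f_\eta^*}(0)-e_{f_\eta^*}(1)|\leq 1$, where $e_{f_\eta^*}(i)$ is the number of edges with label $i$. A graph admitting such a labeling is an arithmetic cordial graph modulo $\eta$ under $\langle S,\zeta_\eta,\star\rangle$. *)

theory Defs
  imports "Graph_Theory.Graph_Theory" "HOL-Number_Theory.Cong"
begin

text \<open>
  Simple graphs are the \<^locale>\<open>pair_graph\<close>s of the library: every edge is represented
  by its two opposite arcs. Edges are therefore counted as two-element vertex sets.
\<close>

definition path_arcs :: "'j \<Rightarrow> nat \<Rightarrow> ('j \<times> nat) rel" where
  "path_arcs j n = {((j, i), (j, i + 1)) | i. 1 \<le> i \<and> i + 1 \<le> n}"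

definition rung_arcs :: "nat \<Rightarrow> (nat \<times> nat) rel" where
  "rung_arcs n = {((1, i), (2, i)) | i. 1 \<le> i \<and> i \<le> n}"

text \<open>The vertex \<open>(j, i)\<close> is the \<open>i\<close>th vertex of the \<open>j\<close>th path.\<close>

definition ladder :: "nat \<Rightarrow> (nat \<times> nat) pair_pre_digraph" where
  "ladder n =
    (let A = path_arcs 1 n \<union> path_arcs 2 n \<union> rung_arcs n
     in \<lparr> pverts = {1, 2} \<times> {1..n}, parcs = A \<union> A\<inverse> \<rparr>)"

text \<open>
  The functions of an arithmetic structure are total in HOL; the values of \<open>\<zeta>\<close> at integers not
  coprime to \<open>\<eta>\<close> and of \<open>star\<close> outside \<open>S \<times> S\<close> play no role.
\<close>

definition arithmetic_structure ::
  "nat \<Rightarrow> int set \<Rightarrow> (int \<Rightarrow> nat) \<Rightarrow> (int \<Rightarrow> int \<Rightarrow> int) \<Rightarrow> bool" where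
  "arithmetic_structure \<eta> S \<zeta> star \<longleftrightarrow> \<eta> > 0 \<and> \<zeta> \<in> {\<xi>. gcd \<xi> (int \<eta>) = 1} \<rightarrow> {0, 1}"

definition induced_label ::
  "nat \<Rightarrow> (int \<Rightarrow> nat) \<Rightarrow> (int \<Rightarrow> int \<Rightarrow> int) \<Rightarrow> ('a \<Rightarrow> int) \<Rightarrow> 'a \<Rightarrow> 'a \<Rightarrow> nat" where
  "induced_label \<eta> \<zeta> star f a b =
    (if gcd (star (f a) (f b)) (int \<eta>) \<noteq> 1 \<or> \<zeta> (star (f a) (f b)) = 0 then 0 else 1)"

definition edge_count ::
  "'a pair_pre_digraph \<Rightarrow> nat \<Rightarrow> (int \<Rightarrow> nat) \<Rightarrow> (int \<Rightarrow> int \<Rightarrow> int) \<Rightarrow> ('a \<Rightarrow> int) \<Rightarrow> nat \<Rightarrow> nat" where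
  "edge_count G \<eta> \<zeta> star f i =
    card {{a, b} | a b. (a, b) \<in> parcs G \<and> induced_label \<eta> \<zeta> star f a b = i}"

text \<open>
  For \<open>star\<close> not commutative the label of an edge \<open>ab\<close> could depend on the order of its ends; the
  second conjunct says that the induced function on edges is well defined.
\<close>

definition arithmetic_cordial_labeling ::
  "'a pair_pre_digraph \<Rightarrow> nat \<Rightarrow> int set \<Rightarrow> (int \<Rightarrow> nat) \<Rightarrow> (int \<Rightarrow> int \<Rightarrow> int) \<Rightarrow> ('a \<Rightarrow> int) \<Rightarrow> bool"
where
  "arithmetic_cordial_labeling G \<eta> S \<zeta> star f \<longleftrightarrow>
    bij_betw f (pverts G) S \<and>
    (\<forall>(a, b) \<in> parcs G. induced_label \<eta> \<zeta> star f a b = induced_label \<eta> \<zeta> star f b a) \<and>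
    \<bar>int (edge_count G \<eta> \<zeta> star f 0) - int (edge_count G \<eta> \<zeta> star f 1)\<bar> \<le> 1"

text \<open>The qualified name avoids the topological notion of connectedness.\<close>

definition arithmetic_cordial_graph ::
  "'a pair_pre_digraph \<Rightarrow> nat \<Rightarrow> int set \<Rightarrow> (int \<Rightarrow> nat) \<Rightarrow> (int \<Rightarrow> int \<Rightarrow> int) \<Rightarrow> bool" where
  "arithmetic_cordial_graph G \<eta> S \<zeta> star \<longleftrightarrow>
    pair_graph G \<and> Digraph_Component.connected (with_proj G) \<and>
    arithmetic_structure \<eta> S \<zeta> star \<and>
    (\<exists>f. arithmetic_cordial_labeling G \<eta> S \<zeta> star f)"

end

theory Submission
  imports Defs
begin

text \<open>
  The labels only matter modulo \<open>p\<close>, and the ladder is labelled so that both vertices of its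
  \<open>i\<close>th rung have residue \<open>i + (p - 1) / 2\<close>: the labels \<open>1, \<dots>, p\<close> run cyclically along the first
  path, starting at \<open>(p + 1) / 2\<close>, and each label on the second path exceeds the one opposite to it
  by \<open>p\<close>. Then the \<open>i\<close>th edge of either path has sum \<open>2 * i + p \<equiv> 2 * i\<close> and the \<open>i\<close>th rung has
  sum \<open>2 * i - 1\<close> modulo \<open>p\<close>. As \<open>2\<close> is invertible modulo \<open>p\<close>, the sums along each path
  (\<open>1 \<le> i < p\<close>) meet every nonzero residue once, and the sums along the rungs
  (\<open>1 \<le> i \<le> p\<close>) meet every residue once.

  As \<open>p\<close> is prime, a sum that is not divisible by \<open>p\<close> is labelled by \<open>\<zeta>\<close>, which depends only on the
  residue and is balanced on the nonzero residues. Hence each path has as many edges of label \<open>0\<close> as of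
  label \<open>1\<close>. So have the rungs, apart from the one rung whose sum is divisible by \<open>p\<close>, which has
  label \<open>0\<close>. Altogether label \<open>0\<close> occurs exactly once more than label \<open>1\<close>.

  The starting point of the cyclic run is what makes this work without a case distinction: a path
  has one edge fewer than there are residues, and the residue it omits is the sum of its first and
  last label. Starting at \<open>(p + 1) / 2\<close> makes this omitted residue \<open>0\<close>, the one residue that
  would disturb the balance on the paths.
\<close>

section \<open>Ladders as simple connected graphs\<close>

lemma pverts_ladder: "pverts (ladder n) = {1, 2} \<times> {1..n}"
  by (simp add: ladder_def Let_def)

lemma parcs_ladder_iff:
  "(a, b) \<in> parcs (ladder n) \<longleftrightarrow>
    (\<exists>i j. j \<in> {1, 2} \<and> 1 \<le> i \<and> i < n \<and> {a, b} = {(j, i), (j, Suc i)}) \<or>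
    (\<exists>i. 1 \<le> i \<and> i \<le> n \<and> {a, b} = {(1, i), (2, i)})"
  by (auto simp: ladder_def Let_def path_arcs_def rung_arcs_def doubleton_eq_iff Suc_le_eq)

lemma pair_graph_ladder: "pair_graph (ladder n)"
proof
  have arcs: "parcs (ladder n) \<subseteq> pverts (ladder n) \<times> pverts (ladder n)"
    by (auto simp: parcs_ladder_iff pverts_ladder doubleton_eq_iff)
  show "fst e \<in> pverts (ladder n)" "snd e \<in> pverts (ladder n)" if "e \<in> parcs (ladder n)" for e
    using arcs that by auto
  show fin: "finite (pverts (ladder n))"
    by (simp add: pverts_ladder)
  show "finite (parcs (ladder n))"
    using finite_subset[OF arcs] fin by simp
  show "fst e \<noteq> snd e" if "e \<in> parcs (ladder n)" for e
    using that by (cases e) (auto simp: parcs_ladder_iff doubleton_eq_iff)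
  show "symmetric (with_proj (ladder n))"
    by (auto simp: symmetric_def sym_def parcs_ladder_iff insert_commute)
qed

text \<open>Every vertex is joined to the first vertex of the first path, by induction along the rungs.\<close>

lemma connected_ladder:
  assumes "n \<ge> 1"
  shows "Digraph_Component.connected (with_proj (ladder n))"
proof -
  interpret pair_graph "ladder n" by (rule pair_graph_ladder)
  let ?R = "reachable (with_proj (ladder n))"
  have to_first: "?R (1, i) (1, 1) \<and> ?R (2, i) (1, 1)" if "i \<in> {1..n}" for i
  proof -
    have "1 \<le> i" "i \<le> n" using that by auto
    then show ?thesis
    proof (induction i rule: dec_induct)
      case base
      have "?R (1, 1) (1, 1)"
        using assms by (intro reachable_refl) (simp add: pverts_ladder)
      moreover have "((2, 1), (1, 1)) \<in> parcs (ladder n)"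
        using assms by (auto simp: parcs_ladder_iff doubleton_eq_iff)
      ultimately show ?case
        using adj_reachable_trans by blast
    next
      case (step i)
      have "((j, Suc i), (j, i)) \<in> parcs (ladder n)" if "j \<in> {1, 2}" for j
        unfolding parcs_ladder_iff using step that
        by (intro disjI1 exI[of _ i] exI[of _ j]) auto
      moreover have "?R (1, i) (1, 1)" "?R (2, i) (1, 1)"
        using step by auto
      ultimately show ?case
        using adj_reachable_trans by blast
    qed
  qed
  have sym: "symmetric (with_proj (ladder n))"
    by (rule pair_sym_arcs)
  show ?thesis
  proof (rule connectedI)
    show "pverts (ladder n) \<noteq> {}"
      using assms by (auto simp: pverts_ladder)
    fix u v
    assume "u \<in> pverts (ladder n)" "v \<in> pverts (ladder n)"
    then have "?R u (1, 1)" "?R v (1, 1)"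
      using to_first by (auto simp: pverts_ladder)
    then have "?R u v"
      using symmetric_reachable[OF sym] reachable_trans by blast
    then show "reachable (with_proj (mk_symmetric (with_proj (ladder n)))) u v"
      by (rule reachable_mk_symmetricI)
  qed
qed

text \<open>
  Counting edges as vertex sets reduces to counting indices: the edges of the two paths and the
  rungs are three disjoint families, each faithfully indexed by position.
\<close>

lemma edge_count_ladder:
  assumes "\<And>x y. star x y = star y x"
  shows "edge_count (ladder n) \<eta> \<zeta> star f k =
    card {i \<in> {1..<n}. induced_label \<eta> \<zeta> star f (1, i) (1, Suc i) = k} +
    card {i \<in> {1..<n}. induced_label \<eta> \<zeta> star f (2, i) (2, Suc i) = k} +
    card {i \<in> {1..n}. induced_label \<eta> \<zeta> star f (1, i) (2, i) = k}"
    (is "_ = card ?P1 + card ?P2 + card ?R")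
proof -
  let ?l = "induced_label \<eta> \<zeta> star f"
  let ?p = "\<lambda>j i :: nat. {(j :: nat, i), (j, Suc i)}" and ?r = "\<lambda>i :: nat. {(1 :: nat, i), (2, i)}"
  have sym: "?l a b = ?l b a" for a b
    by (simp add: induced_label_def assms[of "f a"])
  have "{{a, b} | a b. (a, b) \<in> parcs (ladder n) \<and> ?l a b = k} =
      (?p 1 ` ?P1 \<union> ?p 2 ` ?P2) \<union> ?r ` ?R" (is "?E = ?F")
  proof
    show "?E \<subseteq> ?F"
    proof
      fix e assume "e \<in> ?E"
      then obtain a b where ab: "e = {a, b}" "(a, b) \<in> parcs (ladder n)" "?l a b = k"
        by blast
      from ab(2) consider
        (path) i j where "j \<in> {1, 2}" "i \<in> {1..<n}" "{a, b} = {(j, i), (j, Suc i)}" |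
        (rung) i where "i \<in> {1..n}" "{a, b} = {(1, i), (2, i)}"
        unfolding parcs_ladder_iff by auto
      then show "e \<in> ?F"
      proof cases
        case path
        then have "?l (j, i) (j, Suc i) = k"
          using ab(3) sym by (auto simp: doubleton_eq_iff)
        then show ?thesis using path ab(1) by auto
      next
        case rung
        then have "?l (1, i) (2, i) = k"
          using ab(3) sym by (auto simp: doubleton_eq_iff)
        then show ?thesis using rung ab(1) by auto
      qed
    qed
    show "?F \<subseteq> ?E"
    proof (intro Un_least image_subsetI CollectI)
      show "\<exists>a b. ?p 1 i = {a, b} \<and> (a, b) \<in> parcs (ladder n) \<and> ?l a b = k" if "i \<in> ?P1" for i
        using that by (intro exI[of _ "(1, i)"] exI[of _ "(1, Suc i)"])
          (auto simp: parcs_ladder_iff doubleton_eq_iff)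
      show "\<exists>a b. ?p 2 i = {a, b} \<and> (a, b) \<in> parcs (ladder n) \<and> ?l a b = k" if "i \<in> ?P2" for i
        using that by (intro exI[of _ "(2, i)"] exI[of _ "(2, Suc i)"])
          (auto simp: parcs_ladder_iff doubleton_eq_iff)
      show "\<exists>a b. ?r i = {a, b} \<and> (a, b) \<in> parcs (ladder n) \<and> ?l a b = k" if "i \<in> ?R" for i
        using that by (intro exI[of _ "(1, i)"] exI[of _ "(2, i)"])
          (auto simp: parcs_ladder_iff doubleton_eq_iff)
    qed
  qed
  moreover have "card (?p 1 ` ?P1 \<union> ?p 2 ` ?P2 \<union> ?r ` ?R) = card ?P1 + card ?P2 + card ?R"
  proof -
    have ne: "?p 1 i \<noteq> ?p 2 i'" "?p 1 i \<noteq> ?r i'" "?p 2 i \<noteq> ?r i'" for i i'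
      by (simp_all add: doubleton_eq_iff)
    have images_disjoint: "g ` A \<inter> h ` B = {}" if "\<And>i i'. g i \<noteq> h i'"
      for g h :: "nat \<Rightarrow> (nat \<times> nat) set" and A B
      using that by blast
    have disj: "?p 1 ` ?P1 \<inter> ?p 2 ` ?P2 = {}" "(?p 1 ` ?P1 \<union> ?p 2 ` ?P2) \<inter> ?r ` ?R = {}"
      unfolding Int_Un_distrib2 Un_empty by (intro conjI images_disjoint ne)+
    have "inj_on (?p j) A" "inj_on ?r A" for j A
      by (auto simp: inj_on_def doubleton_eq_iff)
    then have card: "card (?p j ` A) = card A" "card (?r ` A) = card A" for j A
      by (simp_all only: card_image)
    have fin: "finite ?P1" "finite ?P2" "finite ?R"
      by simp_all
    show ?thesis
      by (simp only: card_Un_disjoint[OF _ _ disj(1)] card_Un_disjoint[OF _ _ disj(2)]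
          fin finite_imageI finite_UnI card)
  qed
  ultimately show ?thesis
    unfolding edge_count_def by simp
qed

section \<open>Doubling modulo an odd number\<close>

lemma bij_betw_double_plus_mod:
  fixes n :: nat and b :: int
  assumes "odd n"
  shows "bij_betw (\<lambda>i. (2 * int i + b) mod int n) {1..n} {0..<int n}"
proof -
  have "n > 0" using assms by (rule odd_pos)
  have "inj_on (\<lambda>i. (2 * int i + b) mod int n) {1..n}"
  proof (rule inj_onI)
    fix i j assume ij: "i \<in> {1..n}" "j \<in> {1..n}"
      and eq: "(2 * int i + b) mod int n = (2 * int j + b) mod int n"
    then have "int n dvd 2 * (int i - int j)"
      by (simp add: mod_eq_dvd_iff algebra_simps)
    moreover have "coprime (int n) 2"
      using assms by simp
    ultimately have "int n dvd int i - int j"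
      by (simp only: coprime_dvd_mult_right_iff)
    moreover have "\<bar>int i - int j\<bar> < int n"
      using ij by auto
    ultimately have "int i - int j = 0"
      using dvd_imp_le_int[of "int i - int j" "int n"] by linarith
    then show "i = j" by simp
  qed
  moreover from this have "(\<lambda>i. (2 * int i + b) mod int n) ` {1..n} = {0..<int n}"
    using \<open>n > 0\<close> by (intro card_subset_eq) (auto simp: card_image)
  ultimately show ?thesis
    by (rule bij_betw_imageI)
qed

lemma bij_betw_double_mod_nonzero:
  fixes n :: nat
  assumes "odd n"
  shows "bij_betw (\<lambda>i. (2 * int i) mod int n) {1..<n} {1..int n - 1}"
proof -
  have "n > 0" using assms by (rule odd_pos)
  have "bij_betw (\<lambda>i. (2 * int i) mod int n) ({1..n} - {n}) ({0..<int n} - {0})"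
    using bij_betw_double_plus_mod[OF assms, of 0] \<open>n > 0\<close>
    by (intro bij_betw_DiffI) (auto simp: bij_betw_def)
  moreover have "{1..n} - {n} = {1..<n}" "{0..<int n} - {0} = {1..int n - 1}"
    by auto
  ultimately show ?thesis by simp
qed

lemma card_Collect_bij_betw:
  assumes "bij_betw g A B" "\<And>x. x \<in> A \<Longrightarrow> P x \<longleftrightarrow> Q (g x)"
  shows "card {x \<in> A. P x} = card {y \<in> B. Q y}"
proof -
  have "g ` {x \<in> A. P x} = {y \<in> B. Q y}" "inj_on g {x \<in> A. P x}"
    using assms by (auto simp: bij_betw_def inj_on_def)
  then show ?thesis by (metis card_image)
qed

section \<open>The labelling and its edge sums\<close>

text \<open>For odd \<open>p\<close>, the shift \<open>p div 2\<close> is the solution \<open>s\<close> of \<open>2 * s + 1 = p\<close>.\<close>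

definition rotated_labeling :: "nat \<Rightarrow> nat \<times> nat \<Rightarrow> int" where
  "rotated_labeling p = (\<lambda>(j, i).
    (if i + p div 2 \<le> p then int (i + p div 2) else int (i + p div 2) - int p) +
    (if j = 1 then 0 else int p))"

lemma bij_betw_rotated_labeling:
  "bij_betw (rotated_labeling p) (pverts (ladder p)) {1..2 * int p}"
proof -
  have "inj_on (rotated_labeling p) (pverts (ladder p))"
    by (auto simp: inj_on_def pverts_ladder rotated_labeling_def split: if_splits)
  moreover from this have "rotated_labeling p ` pverts (ladder p) = {1..2 * int p}"
    by (intro card_subset_eq)
      (auto simp: card_image pverts_ladder rotated_labeling_def card_cartesian_product)
  ultimately show ?thesis
    by (rule bij_betw_imageI)
qed

lemma rotated_labeling_cong: "[rotated_labeling p (j, i) = int i + int (p div 2)] (mod int p)"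
  by (simp add: rotated_labeling_def cong_def)

lemma rotated_labeling_path_sum_cong:
  assumes "odd p"
  shows "[rotated_labeling p (j, i) + rotated_labeling p (j, Suc i) = 2 * int i] (mod int p)"
proof -
  have "2 * int (p div 2) + 1 = int p"
    using assms by presburger
  then have "(int i + int (p div 2)) + (int (Suc i) + int (p div 2)) = 2 * int i + int p"
    by simp
  moreover have "[2 * int i + int p = 2 * int i] (mod int p)"
    by (simp add: cong_def)
  ultimately show ?thesis
    by (metis cong_add cong_trans rotated_labeling_cong)
qed

lemma rotated_labeling_rung_sum_cong:
  assumes "odd p"
  shows "[rotated_labeling p (j, i) + rotated_labeling p (k, i) = 2 * int i - 1] (mod int p)"
proof -
  have "2 * int (p div 2) + 1 = int p"
    using assms by presburger
  then have "(int i + int (p div 2)) + (int i + int (p div 2)) = (2 * int i - 1) + int p"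
    by simp
  moreover have "[(2 * int i - 1) + int p = 2 * int i - 1] (mod int p)"
    by (simp add: cong_def)
  ultimately show ?thesis
    by (metis cong_add cong_trans rotated_labeling_cong)
qed

section \<open>Balance\<close>

definition sum_label :: "nat \<Rightarrow> (int \<Rightarrow> nat) \<Rightarrow> int \<Rightarrow> nat" where
  "sum_label \<eta> \<zeta> x = (if gcd x (int \<eta>) \<noteq> 1 \<or> \<zeta> x = 0 then 0 else 1)"

lemma induced_label_eq_sum_label: "induced_label \<eta> \<zeta> star f a b = sum_label \<eta> \<zeta> (star (f a) (f b))"
  by (simp add: induced_label_def sum_label_def)

theorem theorem4p1:
  fixes p :: nat and \<zeta> :: "int \<Rightarrow> nat"
  assumes "prime p" and "odd p" and "p \<ge> 3"
    and "\<zeta> \<in> {\<xi>. gcd \<xi> (int p) = 1} \<rightarrow> {0, 1}"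
    and "\<And>\<theta>\<^sub>1 \<theta>\<^sub>2. gcd \<theta>\<^sub>1 (int p) = 1 \<Longrightarrow> gcd \<theta>\<^sub>2 (int p) = 1 \<Longrightarrow>
           [\<theta>\<^sub>1 = \<theta>\<^sub>2] (mod int p) \<Longrightarrow> \<zeta> \<theta>\<^sub>1 = \<zeta> \<theta>\<^sub>2"
    and "\<And>i. i \<in> {0, 1} \<Longrightarrow> card {a \<in> {1..int p - 1}. \<zeta> a = i} = (p - 1) div 2"
  shows "arithmetic_cordial_graph (ladder p) p {1..2 * int p} \<zeta> (+)"
proof -
  let ?h = "sum_label p \<zeta>" and ?f = "rotated_labeling p" and ?m = "(p - 1) div 2"
  have h_cong: "?h x = ?h y" if "[x = y] (mod int p)" for x y
    using cong_gcd_eq[OF that] assms(5)[OF _ _ that] by (auto simp: sum_label_def gcd.commute)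
  have h_mod: "?h (x mod int p) = ?h x" for x
    by (rule h_cong) (simp add: cong_def)
  have h_0: "?h 0 = 0"
    using assms(3) by (simp add: sum_label_def)
  have h_nonzero: "?h a = \<zeta> a" if "a \<in> {1..int p - 1}" for a
  proof -
    have "\<not> int p dvd a"
      using that zdvd_not_zless[of a "int p"] by auto
    then have "gcd a (int p) = 1"
      using assms(1) by (metis coprime_iff_gcd_eq_1 gcd.commute prime_imp_coprime prime_nat_int_transfer)
    moreover from this have "\<zeta> a \<in> {0, 1}"
      using assms(4) by auto
    ultimately show ?thesis
      by (auto simp: sum_label_def)
  qed
  have nonzero: "card {a \<in> {1..int p - 1}. ?h a = k} = ?m" if "k \<in> {0, 1}" for k
    using assms(6)[OF that] by (simp add: h_nonzero cong: conj_cong)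

  have path: "card {i \<in> {1..<p}. ?h (?f (j, i) + ?f (j, Suc i)) = k} = ?m" if "k \<in> {0, 1}" for j k
  proof -
    have "card {i \<in> {1..<p}. ?h (?f (j, i) + ?f (j, Suc i)) = k} =
        card {a \<in> {1..int p - 1}. ?h a = k}"
      using h_cong[OF rotated_labeling_path_sum_cong[OF assms(2)]] h_mod
      by (intro card_Collect_bij_betw[OF bij_betw_double_mod_nonzero[OF assms(2)]]) simp
    then show ?thesis using nonzero[OF that] by simp
  qed

  have rung: "card {i \<in> {1..p}. ?h (?f (1, i) + ?f (2, i)) = k} = ?m + (if k = 0 then 1 else 0)"
    if "k \<in> {0, 1}" for k
  proof -
    have "card {i \<in> {1..p}. ?h (?f (1, i) + ?f (2, i)) = k} = card {a \<in> {0..<int p}. ?h a = k}"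
      using h_cong[OF rotated_labeling_rung_sum_cong[OF assms(2)]] h_mod
      by (intro card_Collect_bij_betw[OF bij_betw_double_plus_mod[OF assms(2), of "- 1"]]) simp
    also have "{a \<in> {0..<int p}. ?h a = k} =
        (if k = 0 then {0} else {}) \<union> {a \<in> {1..int p - 1}. ?h a = k}"
    proof -
      have "{0..<int p} = insert 0 {1..int p - 1}"
        using assms(3) by auto
      then show ?thesis using h_0 by auto
    qed
    also have "card \<dots> = ?m + (if k = 0 then 1 else 0)"
    proof -
      have "finite {a \<in> {1..int p - 1}. ?h a = k}"
        by (rule finite_subset[of _ "{1..int p - 1}"]) auto
      then show ?thesis
        using nonzero[OF that] by (subst card_Un_disjoint) auto
    qed
    finally show ?thesis .
  qed

  have "edge_count (ladder p) p \<zeta> (+) ?f k = 3 * ?m + (if k = 0 then 1 else 0)"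
    if "k \<in> {0, 1}" for k
    unfolding edge_count_ladder[of "(+)", OF add.commute] induced_label_eq_sum_label
      path[OF that] rung[OF that] by simp
  then have "arithmetic_cordial_labeling (ladder p) p {1..2 * int p} \<zeta> (+) ?f"
    by (simp add: arithmetic_cordial_labeling_def bij_betw_rotated_labeling
        induced_label_eq_sum_label add.commute split_beta)
  moreover have "arithmetic_structure p {1..2 * int p} \<zeta> (+)"
    using assms(3,4) by (simp add: arithmetic_structure_def)
  ultimately show ?thesis
    using pair_graph_ladder connected_ladder[of p] assms(3)
    by (auto simp: arithmetic_cordial_graph_def)
qed

end
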